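(* Let $q$ be a prime power, let $n\ge k\ge1$ be integers, and let $\mathcal{C}$ be a nondegenerate $[n,k,d]_q$ code of maximum weight $w$. Then $$\frac1n\le\frac{q-1}{q^k-1}+\frac14\left(\frac{w-d}{n}\right)^2\frac{q^k-1}{q^{k-2}(q-1)}.$$
   Context: The weight $\omega(v)$ of $v\in\mathbb{F}_q^n$ is the number of its nonzero coordinates. An $[n,k,d]_q$ code is an $\mathbb{F}_q$-linear subspace $\mathcal{C}\subseteq\mathbb{F}_q^n$ of dimension $k\ge1$ with minimum distance $d=\min\{\omega(c): c\in\mathcal{C},\ c\neq 0\}$; its maximum weight is $\max\{\omega(c): c\in\mathcal{C}\}$. It is nondegenerate if there is no coordinate $i$ with $c_i=0$ for all $c\in\mathcal{C}$. *)

theory Defs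
  imports "HOL-Analysis.Cartesian_Space"
begin

text \<open>
  The field with \<open>q\<close> elements is a type \<open>'a\<close> of class \<open>{field, finite}\<close> with \<open>q = CARD('a)\<close>, and
  its \<open>n\<close>-th Cartesian power is \<open>'a ^ 'n\<close> with \<open>n = CARD('n)\<close>.
\<close>

definition hamming_weight :: "('a::zero) ^ ('n::finite) \<Rightarrow> nat" where
  "hamming_weight v = card {i. v $ i \<noteq> 0}"

text \<open>
  \<open>Min\<close> is meaningful only on finite nonempty sets: finiteness comes from the type, and
  \<open>C - {0}\<close> is nonempty for every subspace of dimension at least 1.
\<close>

definition min_distance :: "(('a::{field,finite}) ^ ('n::finite)) set \<Rightarrow> nat" where
  "min_distance C = Min (hamming_weight ` (C - {0}))"

definition max_weight :: "(('a::{field,finite}) ^ ('n::finite)) set \<Rightarrow> nat" where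
  "max_weight C = Max (hamming_weight ` C)"

definition is_code :: "nat \<Rightarrow> nat \<Rightarrow> nat \<Rightarrow> nat \<Rightarrow> (('a::{field,finite}) ^ ('n::finite)) set \<Rightarrow> bool" where
  "is_code q n k d C \<longleftrightarrow>
     q = CARD('a) \<and> n = CARD('n) \<and>
     vec.subspace C \<and> vec.dim C = k \<and> 1 \<le> k \<and> min_distance C = d"

definition nondegenerate :: "(('a::zero) ^ ('n::finite)) set \<Rightarrow> bool" where
  "nondegenerate C \<longleftrightarrow> \<not> (\<exists>i. \<forall>c\<in>C. c $ i = 0)"

end

theory Submission
  imports Defs
begin

text \<open>
  Popoviciu's inequality bounds the variance of the weight of a uniformly random nonzero codeword
  by \<open>(w - d)\<^sup>2 / 4\<close>. Nondegeneracy makes the mean weight explicit. For the second moment, two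
  coordinates vanish together on at least \<open>q ^ k / q\<^sup>2\<close> codewords, so by inclusion-exclusion they are
  both nonzero on at least \<open>q ^ k * (q - 1)\<^sup>2 / q\<^sup>2\<close> codewords; counting the diagonal pairs \<open>i = j\<close>
  exactly yields the term \<open>1 / n\<close>.
\<close>

text \<open>Every nonempty fibre of \<open>f\<close> on \<open>C\<close> is a translate of the
  kernel, so all fibres have the same size. It is applied below to the evaluation of codewords at
  one coordinate and at two.\<close>

lemma card_eq_card_image_times_card_kernel:
  fixes f :: "'b::group_add \<Rightarrow> 'c::group_add"
  assumes fin: "finite C"
    and diff: "\<And>x y. x \<in> C \<Longrightarrow> y \<in> C \<Longrightarrow> x - y \<in> C"
    and add: "\<And>x y. x \<in> C \<Longrightarrow> y \<in> C \<Longrightarrow> x + y \<in> C"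
    and f_diff: "\<And>x y. f (x - y) = f x - f y"
  shows "card C = card (f ` C) * card {c \<in> C. f c = 0}"
proof -
  have f_add: "f (x + y) = f x + f y" for x y
    using f_diff[of "x + y" y] by simp
  have fib: "card {c \<in> C. f c = y} = card {c \<in> C. f c = 0}" if "y \<in> f ` C" for y
  proof -
    obtain x where x: "x \<in> C" "f x = y" using \<open>y \<in> f ` C\<close> by blast
    have "bij_betw (\<lambda>c. c + x) {c \<in> C. f c = 0} {c \<in> C. f c = y}"
      by (rule bij_betw_byWitness[where f' = "\<lambda>c. c - x"])
        (use x in \<open>auto simp: f_add f_diff add diff\<close>)
    then show ?thesis using bij_betw_same_card by fastforce
  qed
  have "card C = (\<Sum>y\<in>f ` C. card {c \<in> C. f c = y})"
    unfolding card_eq_sum by (rule sum.image_gen[OF fin])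
  also have "\<dots> = (\<Sum>y\<in>f ` C. card {c \<in> C. f c = 0})"
    by (rule sum.cong[OF refl fib])
  finally show ?thesis by simp
qed

text \<open>Adjoining an independent \<open>b\<close> multiplies the size of the span by
  \<open>CARD('a)\<close>, because each element of the larger span is uniquely
  \<open>a *s b + x\<close> with \<open>x\<close> in the old span.\<close>

lemma card_span_independent:
  fixes B :: "(('a::{field,finite}) ^ ('n::finite)) set"
  assumes "vec.independent B"
  shows "card (vec.span B) = CARD('a) ^ card B"
proof -
  have "finite B" by simp
  then show ?thesis using assms
  proof (induction B rule: finite_induct)
    case empty
    then show ?case by simp
  next
    case (insert b B)
    have ind: "vec.independent B" and b: "b \<notin> vec.span B"
      using insert.prems insert.hyps vec.independent_insert[of b B] by simp_all
    let ?f = "\<lambda>(a, x). a *s b + x"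
    have "inj_on ?f (UNIV \<times> vec.span B)"
    proof (rule inj_onI, clarify)
      fix a x a' x'
      assume x: "x \<in> vec.span B" "x' \<in> vec.span B" and eq: "a *s b + x = a' *s b + x'"
      have e: "(a - a') *s b = x' - x"
        using eq by (simp add: algebra_simps)
      have "(a - a') *s b \<in> vec.span B" unfolding e by (rule vec.span_diff[OF x(2) x(1)])
      \<comment> \<open>Otherwise scaling by the inverse of \<open>a - a'\<close> would put
        \<open>b\<close> into \<open>vec.span B\<close>.\<close>
      with b have "a = a'"
        using vec.span_scale[of "(a - a') *s b" B "inverse (a - a')"]
        by (cases "a - a' = 0") auto
      with e show "a = a' \<and> x = x'" by simp
    qed
    moreover have "?f ` (UNIV \<times> vec.span B) = vec.span (insert b B)"
    proof (intro set_eqI iffI)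
      fix y assume "y \<in> vec.span (insert b B)"
      then obtain a where a: "y - a *s b \<in> vec.span B" using vec.span_breakdown_eq by blast
      have "y = ?f (a, y - a *s b)" by simp
      with a show "y \<in> ?f ` (UNIV \<times> vec.span B)" by blast
    next
      fix y assume "y \<in> ?f ` (UNIV \<times> vec.span B)"
      then obtain a x where "x \<in> vec.span B" "y = a *s b + x" by auto
      then have "y - a *s b \<in> vec.span B" by simp
      then show "y \<in> vec.span (insert b B)" using vec.span_breakdown_eq by blast
    qed
    ultimately have "card (vec.span (insert b B)) = CARD('a) * card (vec.span B)"
      using card_image[of ?f "UNIV \<times> vec.span B"] by (simp add: card_cartesian_product)
    then show ?case using insert ind by simp
  qed
qed

lemma card_subspace:
  fixes C :: "(('a::{field,finite}) ^ ('n::finite)) set"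
  assumes "vec.subspace C"
  shows "card C = CARD('a) ^ vec.dim C"
proof -
  obtain B where B: "B \<subseteq> C" "vec.independent B" "C \<subseteq> vec.span B" "card B = vec.dim C"
    using vec.basis_exists by blast
  then have "vec.span B = C" using assms by (metis vec.span_subspace)
  then show ?thesis using card_span_independent[OF B(2)] B(4) by simp
qed

text \<open>Nondegeneracy provides a codeword that is nonzero at \<open>i\<close>; its multiples
  take every value there, so evaluation at \<open>i\<close> is onto the field and its kernel has
  index \<open>CARD('a)\<close>.\<close>

lemma card_zero_coordinate:
  fixes C :: "(('a::{field,finite}) ^ ('n::finite)) set"
  assumes sub: "vec.subspace C" and nd: "nondegenerate C"
  shows "card C = CARD('a) * card {c \<in> C. c $ i = 0}"
proof -
  obtain c where c: "c \<in> C" "c $ i \<noteq> 0" using nd by (auto simp: nondegenerate_def)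
  have "y \<in> (\<lambda>c. c $ i) ` C" for y
    by (rule image_eqI[where x = "(y / c $ i) *s c"]) (use c sub vec.subspace_scale in auto)
  then have "(\<lambda>c. c $ i) ` C = UNIV" by blast
  then show ?thesis
    using card_eq_card_image_times_card_kernel[of C "\<lambda>c. c $ i"] sub
    by (simp add: vec.subspace_diff vec.subspace_add)
qed

text \<open>Evaluation at two coordinates has at most \<open>CARD('a)\<^sup>2\<close> values. Only
  an inequality is possible in general, since the two coordinates may be proportional on
  \<open>C\<close> or equal.\<close>

lemma card_zero_coordinate_pair:
  fixes C :: "(('a::{field,finite}) ^ ('n::finite)) set"
  assumes sub: "vec.subspace C"
  shows "card C \<le> CARD('a)\<^sup>2 * card {c \<in> C. c $ i = 0 \<and> c $ j = 0}"
proof -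
  \<comment> \<open>The pair of coordinates is encoded as a vector indexed by \<open>bool\<close>,
    so that \<open>CARD_vec\<close> gives the size of the target.\<close>
  let ?f = "\<lambda>c::'a^'n. \<chi> l::bool. if l then c $ i else c $ j"
  have "card (?f ` C) \<le> CARD('a ^ bool)" by (rule card_mono) auto
  also have "\<dots> = CARD('a)\<^sup>2" by (simp add: CARD_vec)
  finally have "card (?f ` C) \<le> CARD('a)\<^sup>2" .
  moreover have "?f c = 0 \<longleftrightarrow> c $ i = 0 \<and> c $ j = 0" for c
    by (auto simp: vec_eq_iff)
  moreover have "?f (x - y) = ?f x - ?f y" for x y by (auto simp: vec_eq_iff)
  ultimately show ?thesis
    using card_eq_card_image_times_card_kernel[of C ?f] sub
    by (simp add: vec.subspace_diff vec.subspace_add)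
qed

text \<open>Double counting: after swapping the sums, each coordinate is nonzero on exactly the
  fraction \<open>(q - 1) / q\<close> of the codewords, where \<open>q = CARD('a)\<close>.\<close>

lemma sum_hamming_weight:
  fixes C :: "(('a::{field,finite}) ^ ('n::finite)) set"
  assumes sub: "vec.subspace C" and nd: "nondegenerate C"
  shows "(\<Sum>c\<in>C. real (hamming_weight c))
    = real CARD('n) * real (card C) * (real CARD('a) - 1) / real CARD('a)"
proof -
  have w: "real (hamming_weight c) = (\<Sum>i\<in>UNIV. of_bool (c $ i \<noteq> 0))" for c :: "'a^'n"
    by (simp add: hamming_weight_def)
  have "(\<Sum>c\<in>C. of_bool (c $ i \<noteq> 0)) = real (card C) * (real CARD('a) - 1) / real CARD('a)" for i
  proof -
    have "(\<Sum>c\<in>C. of_bool (c $ i \<noteq> 0)) = (\<Sum>c\<in>C. 1 - of_bool (c $ i = 0) :: real)"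
      by (rule sum.cong) auto
    also have "\<dots> = real (card C) - real (card {c \<in> C. c $ i = 0})"
      by (simp add: sum_subtractf Collect_conj_eq Int_commute)
    also have "\<dots> = real (card C) * (real CARD('a) - 1) / real CARD('a)"
      using arg_cong[OF card_zero_coordinate[OF assms, of i], of real] by (simp add: field_simps)
    finally show ?thesis .
  qed
  then show ?thesis unfolding w by (subst sum.swap) simp
qed

text \<open>The last summand is the surplus of the diagonal pairs \<open>i = j\<close> over the generic bound.\<close>

lemma sum_hamming_weight_squared_ge:
  fixes C :: "(('a::{field,finite}) ^ ('n::finite)) set"
  assumes sub: "vec.subspace C" and nd: "nondegenerate C"
  defines "q \<equiv> real CARD('a)" and "n \<equiv> real CARD('n)" and "M \<equiv> real (card C)"
  shows "n\<^sup>2 * M * (q - 1)\<^sup>2 / q\<^sup>2 + n * M * (q - 1) / q\<^sup>2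
    \<le> (\<Sum>c\<in>C. (real (hamming_weight c))\<^sup>2)"
proof -
  have q: "q > 0" by (simp add: q_def)
  let ?b = "\<lambda>c i. of_bool (c $ i \<noteq> (0::'a)) :: real"
  let ?z = "\<lambda>i. real (card {c \<in> C. c $ i = 0})"
  have w: "(real (hamming_weight c))\<^sup>2 = (\<Sum>i\<in>UNIV. \<Sum>j\<in>UNIV. ?b c i * ?b c j)" for c :: "'a^'n"
  proof -
    have "real (hamming_weight c) = (\<Sum>i\<in>UNIV. ?b c i)" by (simp add: hamming_weight_def)
    then show ?thesis by (simp only: power2_eq_square sum_product)
  qed
  have z: "?z i = M / q" for i
    using arg_cong[OF card_zero_coordinate[OF sub nd, of i], of real] q
    by (simp add: field_simps M_def q_def)
  have pair: "M * (q - 1)\<^sup>2 / q\<^sup>2 + (if i = j then M * (q - 1) / q\<^sup>2 else 0) \<le> (\<Sum>c\<in>C. ?b c i * ?b c j)"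
    for i j
  proof -
    let ?zz = "real (card {c \<in> C. c $ i = 0 \<and> c $ j = 0})"
    \<comment> \<open>Inclusion-exclusion: this expands the product of
      \<open>1 - of_bool (c $ i = 0)\<close> and \<open>1 - of_bool (c $ j = 0)\<close>.\<close>
    have "(\<Sum>c\<in>C. ?b c i * ?b c j)
      = (\<Sum>c\<in>C. 1 - of_bool (c $ i = 0) - of_bool (c $ j = 0) + of_bool (c $ i = 0 \<and> c $ j = 0))"
      by (rule sum.cong) auto
    also have "\<dots> = M - ?z i - ?z j + ?zz"
      by (simp add: sum_subtractf sum.distrib M_def Collect_conj_eq Int_commute Int_assoc
          del: of_bool_conj sum_of_bool_mult_eq sum_mult_of_bool_eq)
    finally have eq: "(\<Sum>c\<in>C. ?b c i * ?b c j) = M - 2 * M / q + ?zz" by (simp add: z)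
    show ?thesis
    proof (cases "i = j")
      case True
      \<comment> \<open>On the diagonal the count is exact, and the bound becomes an equality:
        \<open>M * (q - 1) / q\<close> exceeds \<open>M * (q - 1)\<^sup>2 / q\<^sup>2\<close> by
        \<open>M * (q - 1) / q\<^sup>2\<close>.\<close>
      then have "?zz = M / q" using z by simp
      with True q show ?thesis unfolding eq by (simp add: field_simps power2_eq_square)
    next
      case False
      have "M \<le> q\<^sup>2 * ?zz"
        using of_nat_mono[OF card_zero_coordinate_pair[OF sub, of i j], where 'a = real]
        by (simp add: M_def q_def)
      then have "M / q\<^sup>2 \<le> ?zz" using q by (simp add: field_simps)
      moreover have "M * (q - 1)\<^sup>2 / q\<^sup>2 = M - 2 * M / q + M / q\<^sup>2"
        using q by (simp add: field_simps power2_eq_square)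
      ultimately show ?thesis using False unfolding eq by simp
    qed
  qed
  have "n\<^sup>2 * M * (q - 1)\<^sup>2 / q\<^sup>2 + n * M * (q - 1) / q\<^sup>2 =
    (\<Sum>i\<in>(UNIV::'n set). \<Sum>j\<in>UNIV. M * (q - 1)\<^sup>2 / q\<^sup>2 + (if i = j then M * (q - 1) / q\<^sup>2 else 0))"
    by (simp add: sum.distrib n_def power2_eq_square distrib_left mult.assoc)
  also have "\<dots> \<le> (\<Sum>i\<in>UNIV. \<Sum>j\<in>UNIV. \<Sum>c\<in>C. ?b c i * ?b c j)"
    by (intro sum_mono pair)
  also have "\<dots> = (\<Sum>i\<in>UNIV. \<Sum>c\<in>C. \<Sum>j\<in>UNIV. ?b c i * ?b c j)"
    by (rule sum.cong[OF refl], rule sum.swap)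
  also have "\<dots> = (\<Sum>c\<in>C. (real (hamming_weight c))\<^sup>2)"
    unfolding w by (rule sum.swap)
  finally show ?thesis .
qed

text \<open>Summing \<open>(f x - a) * (b - f x) \<ge> 0\<close> bounds the second moment linearly
  in the first. The variance bound is multiplied by \<open>(real (card A))\<^sup>2\<close> to avoid
  division.\<close>

lemma popoviciu_inequality:
  fixes f :: "'b \<Rightarrow> real"
  assumes "\<And>x. x \<in> A \<Longrightarrow> a \<le> f x" and "\<And>x. x \<in> A \<Longrightarrow> f x \<le> b"
  shows "card A * (\<Sum>x\<in>A. (f x)\<^sup>2) - (\<Sum>x\<in>A. f x)\<^sup>2 \<le> (real (card A))\<^sup>2 * ((b - a)\<^sup>2 / 4)"
proof -
  let ?N = "real (card A)" and ?S = "\<Sum>x\<in>A. f x" and ?T = "\<Sum>x\<in>A. (f x)\<^sup>2"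
  have "0 \<le> (\<Sum>x\<in>A. (f x - a) * (b - f x))"
    using assms by (intro sum_nonneg mult_nonneg_nonneg) auto
  also have "\<dots> = (\<Sum>x\<in>A. (a + b) * f x - (f x)\<^sup>2 - a * b)"
    by (rule sum.cong) (auto simp: algebra_simps power2_eq_square)
  also have "\<dots> = (a + b) * ?S - ?T - ?N * (a * b)"
    by (simp add: sum_subtractf sum_distrib_left)
  finally have "?N * ?T \<le> ?N * ((a + b) * ?S - ?N * (a * b))"
    by (intro mult_left_mono) auto
  \<comment> \<open>Completing the square in \<open>?S\<close>: the quadratic left over is largest
    when the mean is the midpoint of \<open>a\<close> and \<open>b\<close>.\<close>
  moreover have "0 \<le> (?S - ?N * ((a + b) / 2))\<^sup>2" by simp
  ultimately show ?thesis by (simp add: field_simps power2_eq_square)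
qed

theorem proposition3p10:
  fixes C :: "(('a::{field,finite}) ^ ('n::finite)) set" and q n k d w :: nat
  assumes "1 \<le> k" and "k \<le> n"
    and "is_code q n k d C"
    and "nondegenerate C"
    and "max_weight C = w"
  shows "1 / real n \<le> (real q - 1) / (real q ^ k - 1)
           + 1 / 4 * ((real w - real d) / real n)\<^sup>2
             * ((real q ^ k - 1) / (real q powi (int k - 2) * (real q - 1)))"
proof -
  have q: "q = CARD('a)" and n: "n = CARD('n)" and sub: "vec.subspace C"
    and k: "vec.dim C = k" and d: "min_distance C = d"
    using assms(3) by (auto simp: is_code_def)
  let ?q = "real q" and ?n = "real n" and ?A = "C - {0}"
  define M where "M = ?q ^ k"
  have M: "real (card C) = M" using card_subspace[OF sub] by (simp add: M_def q k)
  have q1: "?q > 1" using card_mono[of "UNIV::'a set" "{0, 1}"] by (simp add: q)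
  have M1: "M > 1" unfolding M_def using q1 assms(1) by (simp add: one_less_power)
  have n0: "?n > 0" by (simp add: n)
  have zero: "0 \<in> C" using sub by (rule vec.subspace_0)
  have N: "real (card ?A) = M - 1"
    using zero M M1 by (simp add: of_nat_diff)
  have wt0: "hamming_weight (0 :: 'a^'n) = 0" by (simp add: hamming_weight_def)
  \<comment> \<open>Dropping the zero word leaves both moments unchanged but lowers the count to
    \<open>M - 1\<close>, and it makes \<open>d\<close> rather than 0 a lower bound for the
    weights.\<close>
  have S: "(\<Sum>c\<in>?A. real (hamming_weight c)) = ?n * M * (?q - 1) / ?q"
    using sum_hamming_weight[OF sub assms(4)] zero wt0 by (simp add: sum_diff1 M q n)
  have T: "?n\<^sup>2 * M * (?q - 1)\<^sup>2 / ?q\<^sup>2 + ?n * M * (?q - 1) / ?q\<^sup>2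
      \<le> (\<Sum>c\<in>?A. (real (hamming_weight c))\<^sup>2)"
    using sum_hamming_weight_squared_ge[OF sub assms(4)] zero wt0 by (simp add: sum_diff1 M q n)
  have "(M - 1) * (\<Sum>c\<in>?A. (real (hamming_weight c))\<^sup>2) - (?n * M * (?q - 1) / ?q)\<^sup>2
      \<le> (M - 1)\<^sup>2 * ((real w - real d)\<^sup>2 / 4)"
    unfolding S[symmetric] N[symmetric]
  proof (rule popoviciu_inequality)
    fix c assume "c \<in> ?A"
    then show "real d \<le> real (hamming_weight c)" "real (hamming_weight c) \<le> real w"
      unfolding d[symmetric] assms(5)[symmetric] min_distance_def max_weight_def by auto
  qed
  with mult_left_mono[OF T, of "M - 1"] M1
  have main: "(M - 1) * (?n\<^sup>2 * M * (?q - 1)\<^sup>2 / ?q\<^sup>2 + ?n * M * (?q - 1) / ?q\<^sup>2)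
      - (?n * M * (?q - 1) / ?q)\<^sup>2 \<le> (M - 1)\<^sup>2 * ((real w - real d)\<^sup>2 / 4)"
    by linarith
  \<comment> \<open>The exponent is an integer because it is negative for
    \<open>k = 1\<close>.\<close>
  have powi: "?q powi (int k - 2) = M / ?q\<^sup>2"
    using q1 by (simp add: power_int_diff M_def)
  \<comment> \<open>The left side of \<open>main\<close> simplifies to \<open>?n * M * (M - 1) * (?q
    - 1) / ?q\<^sup>2 - ?n\<^sup>2 * M * (?q - 1)\<^sup>2 / ?q\<^sup>2\<close>; dividing by
    \<open>?D\<close> turns these terms into \<open>1 / ?n\<close> and
    \<open>(?q - 1) / (M - 1)\<close>.\<close>
  let ?D = "?n\<^sup>2 * (M - 1) * M * (?q - 1) / ?q\<^sup>2"
  have D: "?D > 0" using n0 M1 q1 by simp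
  have "1 / ?n - (?q - 1) / (M - 1)
      = ((M - 1) * (?n\<^sup>2 * M * (?q - 1)\<^sup>2 / ?q\<^sup>2 + ?n * M * (?q - 1) / ?q\<^sup>2)
      - (?n * M * (?q - 1) / ?q)\<^sup>2) / ?D"
    using n0 M1 q1 by (simp add: divide_simps) (simp add: algebra_simps power2_eq_square)
  also have "\<dots> \<le> (M - 1)\<^sup>2 * ((real w - real d)\<^sup>2 / 4) / ?D"
    using main D by (intro divide_right_mono) auto
  also have "\<dots> = 1 / 4 * ((real w - real d) / ?n)\<^sup>2 * ((M - 1) / (M / ?q\<^sup>2 * (?q - 1)))"
  proof -
    \<comment> \<open>The variables \<open>u\<close>, \<open>p\<close> and \<open>W\<close> stand
      for \<open>M - 1\<close>, \<open>?q - 1\<close> and the squared weight gap, so that the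
      differences cancel as atoms instead of being multiplied out.\<close>
    have "u\<^sup>2 * (W / 4) / (?n\<^sup>2 * u * M * p / ?q\<^sup>2) = 1 / 4 * (W / ?n\<^sup>2) * (u / (M / ?q\<^sup>2 * p))"
      if "u \<noteq> 0" "p \<noteq> 0" for u p W :: real
      using that n0 M1 q1 by (simp add: field_simps power2_eq_square)
    from this[of "M - 1" "?q - 1" "(real w - real d)\<^sup>2"] show ?thesis
      using M1 q1 by (simp add: power_divide)
  qed
  finally show ?thesis unfolding powi M_def[symmetric] by linarith
qed

end
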